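(* Let $3\le p\le q$ and $n=p+q$, and let $\mathscr{T}_n^{p,q}$ be the set of all $n$-vertex trees whose bipartition has parts of sizes $p$ and $q$. Then the tree $T(p,q)$ is the unique tree in $\mathscr{T}_n^{p,q}$ with the minimal eccentric distance sum, where $T(p,q)$ is obtained from an edge $xy$ by attaching $q-1$ pendant vertices to $x$ and $p-1$ pendant vertices to $y$.
   Context: All graphs are simple and connected. For a graph $G$ and vertices $u,v$, $d_G(u,v)$ is the distance; $D_G(v)=\sum_{u\in V_G}d_G(u,v)$; the eccentricity $\varepsilon_G(v)$ is the maximum distance from $v$ to any vertex. The eccentric distance sum is $\xi^d(G)=\sum_{v\in V_G}\varepsilon_G(v)D_G(v)$. A tree has a $(p,q)$-bipartition if its vertex set splits into two independent sets of sizes $p$ and $q$. *)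

theory Defs
  imports "Graph_Theory.Graph_Theory"
begin

text \<open>
  A finite simple undirected graph is a \<^locale>\<open>pair_graph\<close>: a finite, loopfree, symmetric set of
  arcs on a finite vertex set, an undirected edge \<open>uv\<close> being the two arcs \<open>(u, v)\<close> and \<open>(v, u)\<close>.
\<close>

text \<open>
  Only meaningful when \<open>v\<close> is reachable from \<open>u\<close>: otherwise the value is \<open>Inf {} = 0\<close>.
\<close>
definition distance :: "'a pair_pre_digraph \<Rightarrow> 'a \<Rightarrow> 'a \<Rightarrow> nat" where
  "distance G u v = Inf (length ` {w. pre_digraph.awalk (with_proj G) u w v})"

definition distance_sum :: "'a pair_pre_digraph \<Rightarrow> 'a \<Rightarrow> nat" where
  "distance_sum G v = (\<Sum>u\<in>pverts G. distance G u v)"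

definition eccentricity :: "'a pair_pre_digraph \<Rightarrow> 'a \<Rightarrow> nat" where
  "eccentricity G v = Max ((\<lambda>u. distance G v u) ` pverts G)"

definition eccentric_distance_sum :: "'a pair_pre_digraph \<Rightarrow> nat" where
  "eccentric_distance_sum G = (\<Sum>v\<in>pverts G. eccentricity G v * distance_sum G v)"

text \<open>
  The library's \<^const>\<open>tree\<close> cannot be used here: in a symmetric digraph every edge yields the
  directed cycle \<open>u, v, u\<close>.  An undirected cycle is a directed one of length at least 3.
\<close>
definition undirected_tree :: "'a pair_pre_digraph \<Rightarrow> bool" where
  "undirected_tree G \<longleftrightarrow> pair_graph G \<and> connected (with_proj G)
     \<and> \<not> (\<exists>c. pre_digraph.cycle (with_proj G) c \<and> 3 \<le> length c)"

definition independent_set :: "'a pair_pre_digraph \<Rightarrow> 'a set \<Rightarrow> bool" where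
  "independent_set G A \<longleftrightarrow> A \<subseteq> pverts G \<and> (\<forall>u\<in>A. \<forall>v\<in>A. (u, v) \<notin> parcs G)"

definition has_bipartition :: "nat \<Rightarrow> nat \<Rightarrow> 'a pair_pre_digraph \<Rightarrow> bool" where
  "has_bipartition p q G \<longleftrightarrow> (\<exists>A B. A \<union> B = pverts G \<and> A \<inter> B = {}
     \<and> independent_set G A \<and> independent_set G B \<and> card A = p \<and> card B = q)"

definition bipartition_trees :: "nat \<Rightarrow> nat \<Rightarrow> nat \<Rightarrow> 'a pair_pre_digraph set" where
  "bipartition_trees n p q =
     {G. undirected_tree G \<and> card (pverts G) = n \<and> has_bipartition p q G}"

definition edge_graph :: "'a \<Rightarrow> 'a \<Rightarrow> 'a pair_pre_digraph" where
  "edge_graph x y = \<lparr>pverts = {x, y}, parcs = {(x, y), (y, x)}\<rparr>"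

text \<open>\<open>S\<close> is meant to be disjoint from the vertices of \<open>G\<close>.\<close>
definition attach_pendants :: "'a \<Rightarrow> 'a set \<Rightarrow> 'a pair_pre_digraph \<Rightarrow> 'a pair_pre_digraph" where
  "attach_pendants v S G =
     \<lparr>pverts = pverts G \<union> S, parcs = parcs G \<union> {v} \<times> S \<union> S \<times> {v}\<rparr>"

text \<open>
  The tree \<open>T(p, q)\<close> for \<open>p, q \<ge> 1\<close>, on the vertices \<open>0, \<dots>, p + q - 1\<close> with \<open>x = 0\<close> and \<open>y = 1\<close>;
  the two intervals have \<open>q - 1\<close> and \<open>p - 1\<close> elements.
\<close>
definition double_star :: "nat \<Rightarrow> nat \<Rightarrow> nat pair_pre_digraph" where
  "double_star p q =
     attach_pendants 1 {q + 1..<p + q} (attach_pendants 0 {2..<q + 1} (edge_graph 0 1))"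

text \<open>
  \<^const>\<open>distance\<close> is the library's shortest path length for unit weights, as a natural number.
\<close>
lemma (in pair_wf_digraph) distance_eq_unit_cost:
  assumes "awalk u w v"
  shows "ereal (real (distance G u v)) = \<mu> (\<lambda>_. 1) u v"
proof -
  let ?L = "length ` {w. awalk u w v}"
  have ne: "?L \<noteq> {}" using assms by auto
  have cost: "awalk_cost (\<lambda>_. 1) p = real (length p)" for p
    by (induct p) auto
  have d: "distance G u v = Inf ?L" by (simp add: distance_def)
  have "distance G u v \<in> ?L" unfolding d using ne by (rule Inf_nat_def1)
  then obtain p where p: "awalk u p v" "distance G u v = length p" by auto
  have "distance G u v \<le> length p'" if "awalk u p' v" for p'
    unfolding d using that by (intro cInf_lower) auto
  then show ?thesis
    unfolding \<mu>_def cost using p by (intro antisym INF_greatest INF_lower2[of p]) auto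
qed

end

theory Submission
  imports Defs
begin

text \<open>
  In a tree with parts \<open>A\<close>, \<open>B\<close> of sizes \<open>p\<close>, \<open>q\<close>, distinct vertices of one part are at distance at
  least 2 and non-adjacent vertices of different parts at distance at least 3; as the tree has
  \<open>p + q - 1\<close> edges, this bounds the sum of all \<open>D(v)\<close> from below.  Every eccentricity is at least 3
  except at a vertex adjacent to the whole opposite part, where it is 2.  Acyclicity allows at most
  one such vertex in each part, and the value of \<open>D\<close> there is known.  Hence the eccentric distance
  sum is strictly larger than that of \<open>T(p, q)\<close> unless both parts contain such a vertex, and then
  these two vertices are the centres of a double star.
\<close>

section \<open>Cycles and the number of edges\<close>

text \<open>Take a longest path. All neighbours of its first vertex lie on it, and the farther of
  two of them closes a cycle.\<close>

lemma (in pair_graph) cycle_if_two_neighbors: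
  assumes ne: "pverts G \<noteq> {}"
    and deg: "\<And>v. v \<in> pverts G \<Longrightarrow> \<exists>a b. a \<noteq> b \<and> (v, a) \<in> parcs G \<and> (v, b) \<in> parcs G"
  shows "\<exists>c. cycle c \<and> 3 \<le> length c"
proof -
  let ?P = "\<lambda>k. \<exists>u p v. apath u p v \<and> length p = k"
  have bound: "k \<le> card (pverts G)" if k: "?P k" for k
  proof -
    obtain u p v where p: "apath u p v" "length p = k" using k by blast
    then have "distinct (awalk_verts u p)" "set (awalk_verts u p) \<subseteq> pverts G"
      by (auto simp: apath_def)
    then have "length (awalk_verts u p) \<le> card (pverts G)"
      by (metis card_mono distinct_card pair_finite_verts)
    then show ?thesis using p by (simp add: length_awalk_verts)
  qed
  obtain r where "r \<in> pverts G" using ne by blast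
  then have "?P 0" using apath_Nil_iff by fastforce
  \<comment> \<open>A longest path exists: the vertices of a path are distinct, so its length is
    bounded by the number of vertices.\<close>
  then have "?P (Greatest ?P)"
    using bound by (intro GreatestI_nat[where P = ?P and b = "card (pverts G)"])
  moreover have "j \<le> Greatest ?P" if "?P j" for j
    using that bound by (intro Greatest_le_nat[where P = ?P and b = "card (pverts G)"])
  ultimately obtain k where k: "?P k" "\<And>j. ?P j \<Longrightarrow> j \<le> k" by blast
  obtain u p v where p: "apath u p v" "length p = k" using k by blast
  then have w: "awalk u p v" and d: "distinct (awalk_verts u p)" by (auto simp: apath_def)
  \<comment> \<open>A neighbour \<open>a\<close> off the path could be put in front of it, giving a
    path of length \<open>Suc k\<close>.\<close>
  have onpath: "\<exists>q r. p = q @ r \<and> awalk u q a \<and> q \<noteq> []" if a: "(u, a) \<in> parcs G" for a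
  proof -
    have "(a, u) \<in> parcs G" using a arcs_symmetric by blast
    moreover have "\<not> ?P (Suc k)" using k(2)[of "Suc k"] by auto
    moreover have "apath a ((a, u) # p) v" if "(a, u) \<in> parcs G" "a \<notin> set (awalk_verts u p)"
      using p that by (simp add: apath_Cons_iff)
    ultimately have "a \<in> set (awalk_verts u p)" using p(2) by (metis length_Cons)
    then obtain q r where "p = q @ r" "awalk u q a" using awalk_decomp[OF w] by blast
    moreover have "q \<noteq> []" using \<open>awalk u q a\<close> a no_loops' by (auto simp: awalk_Nil_iff)
    ultimately show ?thesis by blast
  qed
  have "u \<in> pverts G" using w by auto
  then obtain a b where ab: "a \<noteq> b" "(u, a) \<in> parcs G" "(u, b) \<in> parcs G" using deg by blast
  obtain q r q' r' where q: "p = q @ r" "awalk u q a" "q \<noteq> []"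
    and q': "p = q' @ r'" "awalk u q' b" "q' \<noteq> []"
    using onpath[OF ab(2)] onpath[OF ab(3)] by blast
  \<comment> \<open>Prefixes of \<open>p\<close> of equal length coincide and so would end in the
    same neighbour.\<close>
  have "length q \<noteq> length q'"
  proof
    assume "length q = length q'"
    then have "q = q'" using q q' by auto
    then show False using q q' ab awalk_ends by blast
  qed
  moreover have "length q \<noteq> 0" "length q' \<noteq> 0" using q q' by auto
  ultimately have "2 \<le> length q \<or> 2 \<le> length q'" by linarith
  then obtain s t c where s: "p = s @ t" "awalk u s c" "2 \<le> length s" "(u, c) \<in> parcs G"
    using q q' ab by blast
  \<comment> \<open>The prefix \<open>s\<close> has at least two arcs, so closing it with
    \<open>(c, u)\<close> gives length at least 3 and not the trivial back-and-forth walk.\<close>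
  have "awalk c ((c, u) # s) c" using s arcs_symmetric by (auto simp: awalk_Cons_iff)
  moreover have "distinct (awalk_verts u s)"
    using d w s(1) by (auto simp: awalk_verts_append)
  ultimately have "cycle ((c, u) # s)" unfolding cycle_def by force
  then show ?thesis using s(3) by (intro exI[of _ "(c, u) # s"]) auto
qed

lemma cycle_mono:
  assumes "pre_digraph.cycle (with_proj H) c" "pverts H \<subseteq> pverts G" "parcs H \<subseteq> parcs G"
  shows "pre_digraph.cycle (with_proj G) c"
  using assms
  by (auto simp: pre_digraph.cycle_def pre_digraph.awalk_def cas_with_proj_eq
      awalk_verts_with_proj_eq)

text \<open>Some vertex has at most one neighbour, and deleting it loses at most two arcs. As an
  edge is two arcs, this is the bound of one edge fewer than vertices. It is stated for acyclic
  graphs in general, so the induction carries no connectivity along.\<close>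

lemma card_parcs_le:
  assumes "pair_graph G" "pverts G \<noteq> {}"
    and "\<not> (\<exists>c. pre_digraph.cycle (with_proj G) c \<and> 3 \<le> length c)"
  shows "card (parcs G) + 2 \<le> 2 * card (pverts G)"
  using assms
proof (induction "card (pverts G)" arbitrary: G rule: less_induct)
  case less
  interpret pair_graph G by fact
  have "\<not> (\<forall>v\<in>pverts G. \<exists>a b. a \<noteq> b \<and> (v, a) \<in> parcs G \<and> (v, b) \<in> parcs G)"
  proof
    assume "\<forall>v\<in>pverts G. \<exists>a b. a \<noteq> b \<and> (v, a) \<in> parcs G \<and> (v, b) \<in> parcs G"
    then have "\<exists>c. cycle c \<and> 3 \<le> length c"
      by (intro cycle_if_two_neighbors less.prems(2)) (rule bspec)
    then show False by (rule notE[OF less.prems(3)])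
  qed
  then obtain v where v: "v \<in> pverts G"
    and nb: "\<And>a b. (v, a) \<in> parcs G \<Longrightarrow> (v, b) \<in> parcs G \<Longrightarrow> a = b"
    by auto
  define H where "H = \<lparr>pverts = pverts G - {v}, parcs = {e \<in> parcs G. fst e \<noteq> v \<and> snd e \<noteq> v}\<rparr>"
  have H: "pverts H = pverts G - {v}" "parcs H = {e \<in> parcs G. fst e \<noteq> v \<and> snd e \<noteq> v}"
    by (auto simp: H_def)
  have pgH: "pair_graph H"
  proof
    show "finite (pverts H)" "finite (parcs H)" by (auto simp: H)
    show "symmetric (with_proj H)"
      unfolding symmetric_def by (rule symI) (simp add: H arcs_symmetric)
  qed (use no_loops in \<open>auto simp: H dest: wellformed'\<close>)
  have card: "card (pverts G) = Suc (card (pverts H))"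
    using v by (metis H(1) card_Suc_Diff1 pair_finite_verts)
  show ?case
  proof (cases "pverts H = {}")
    case True
    then have "pverts G = {v}" using v H by auto
    then have "(a, b) \<notin> parcs G" for a b using wellformed'[of a b] no_loops'[of a b] by auto
    then have "parcs G = {}" by auto
    then show ?thesis using card by simp
  next
    case False
    have "\<not> (\<exists>c. pre_digraph.cycle (with_proj H) c \<and> 3 \<le> length c)"
      using less.prems(3) cycle_mono[of H _ G] unfolding H by blast
    then have IH: "card (parcs H) + 2 \<le> 2 * card (pverts H)"
      using less.hyps[of H] pgH False card by simp
    \<comment> \<open>The only neighbour of \<open>v\<close> if there is one, and arbitrary
      otherwise; the count below covers both cases.\<close>
    obtain a where a: "b = a" if "(v, b) \<in> parcs G" for b
      using nb by (cases "\<exists>b. (v, b) \<in> parcs G") auto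
    have "(b, c) \<in> parcs H \<union> {(v, a), (a, v)}" if "(b, c) \<in> parcs G" for b c
      using that a[of b] a[of c] arcs_symmetric[OF that] by (auto simp: H)
    then have "parcs G \<subseteq> parcs H \<union> {(v, a), (a, v)}" by (rule subrelI)
    moreover have "finite (parcs H)" by (simp add: H)
    ultimately have "card (parcs G) \<le> card (parcs H \<union> {(v, a), (a, v)})"
      by (intro card_mono) simp_all
    also have "\<dots> \<le> card (parcs H) + card {(v, a), (a, v)}" by (rule card_Un_le)
    also have "\<dots> \<le> card (parcs H) + 2" using card_length[of "[(v, a), (a, v)]"] by simp
    finally show ?thesis using IH card by simp
  qed
qed

section \<open>Distances in bipartite trees\<close>

lemma (in pair_wf_digraph) distance_le:
  assumes "awalk u w v"
  shows "distance G u v \<le> length w"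
  unfolding distance_def using assms by (intro cInf_lower) auto

lemma (in pair_wf_digraph) distance_attained:
  assumes "awalk u w v"
  obtains w' where "awalk u w' v" "length w' = distance G u v"
proof -
  have "distance G u v \<in> length ` {w. awalk u w v}"
    unfolding distance_def using assms by (intro Inf_nat_def1) auto
  then show ?thesis using that by auto
qed

lemma length_rev_path: "length (rev_path w) = length w"
  by (induction w) auto

lemma (in pair_sym_digraph) distance_commute: "distance G u v = distance G v u"
proof -
  have "length ` {w. awalk a w b} \<subseteq> length ` {w. awalk b w a}" for a b
    by (auto intro!: rev_image_eqI[of "rev_path w" for w] simp: length_rev_path)
  then show ?thesis unfolding distance_def by (metis subset_antisym)
qed

text \<open>Used with \<open>B\<close> the part opposite to \<open>v\<close>: within its part, only
  such a vertex can have eccentricity 2.\<close>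

definition dominates :: "'a pair_pre_digraph \<Rightarrow> 'a set \<Rightarrow> 'a \<Rightarrow> bool" where
  "dominates G B v \<longleftrightarrow> (\<forall>u\<in>B. (v, u) \<in> parcs G)"

locale bipartite_tree = pair_graph G for G :: "'a pair_pre_digraph" +
  fixes A B :: "'a set"
  assumes connected: "connected (with_proj G)"
    and acyclic: "\<not> (\<exists>c. cycle c \<and> 3 \<le> length c)"
    and verts_eq: "pverts G = A \<union> B"
    and disjoint: "A \<inter> B = {}"
    and indep_A: "\<And>u v. u \<in> A \<Longrightarrow> v \<in> A \<Longrightarrow> (u, v) \<notin> parcs G"
    and indep_B: "\<And>u v. u \<in> B \<Longrightarrow> v \<in> B \<Longrightarrow> (u, v) \<notin> parcs G"
    and card_A: "2 \<le> card A"
    and card_B: "2 \<le> card B"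
begin

text \<open>The assumptions are symmetric in the parts, so every result on \<open>A\<close> carries
  over to \<open>B\<close>.\<close>

lemma swap: "bipartite_tree G B A"
proof
  show "pverts G = B \<union> A" "B \<inter> A = {}" using verts_eq disjoint by blast+
qed (fact connected acyclic indep_A indep_B card_A card_B)+

lemma finite_A: "finite A" and finite_B: "finite B"
  using pair_finite_verts verts_eq by auto

lemma shortest_walk:
  assumes "u \<in> pverts G" "v \<in> pverts G"
  obtains w where "awalk u w v" "length w = distance G u v"
proof -
  have "u \<rightarrow>\<^sup>*\<^bsub>with_proj G\<^esub> v"
    using assms symmetric_connected_imp_strongly_connected[OF pair_sym_arcs connected]
    by (simp add: strongly_connected_def)
  then obtain w where "awalk u w v" by (auto simp: reachable_awalk)
  then show ?thesis using that by (rule distance_attained)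
qed

lemma distance_same_ge_2:
  assumes "u \<in> A" "v \<in> A" "u \<noteq> v"
  shows "2 \<le> distance G u v"
proof -
  obtain w where w: "awalk u w v" "length w = distance G u v"
    using shortest_walk[of u v] assms verts_eq by blast
  show ?thesis
  proof (rule ccontr)
    assume "\<not> 2 \<le> distance G u v"
    then have "length w < 2" using w by simp
    then consider "w = []" | e where "w = [e]"
      by (cases w) auto
    then show False
      using w(1) assms(3) indep_A[OF assms(1,2)] by cases (auto simp: awalk_simps)
  qed
qed

text \<open>A walk of length 2 between the parts is impossible: its middle vertex would share a part
  with one of its neighbours.\<close>

lemma distance_opposite_ge_3:
  assumes "u \<in> A" "v \<in> B" "(u, v) \<notin> parcs G"
  shows "3 \<le> distance G u v"
proof -
  obtain w where w: "awalk u w v" "length w = distance G u v"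
    using shortest_walk[of u v] assms verts_eq by blast
  show ?thesis
  proof (rule ccontr)
    assume "\<not> 3 \<le> distance G u v"
    then have "length w < 3" using w by simp
    then consider "w = []" | e where "w = [e]" | e f where "w = [e, f]"
      by (cases w; cases "tl w") auto
    then show False
    proof cases
      case 1
      then show False using w(1) assms disjoint by (auto simp: awalk_simps)
    next
      case 2
      then show False using w(1) assms by (auto simp: awalk_simps)
    next
      case (3 e f)
      then have "(u, snd e) \<in> parcs G" "(snd e, v) \<in> parcs G"
        using w(1) by (cases e; cases f; auto simp: awalk_simps)+
      moreover from this have "snd e \<in> A \<union> B" using wellformed' verts_eq by blast
      ultimately show False using assms indep_A indep_B by blast
    qed
  qed
qed

lemma distance_opposite_ge_1:
  assumes "u \<in> A" "v \<in> B"
  shows "1 \<le> distance G u v"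
proof -
  obtain w where w: "awalk u w v" "length w = distance G u v"
    using shortest_walk[of u v] assms verts_eq by blast
  then have "w \<noteq> []" using assms disjoint by (auto simp: awalk_simps)
  then show ?thesis using w by (cases w) auto
qed

section \<open>Lower bounds for distance sums and eccentricities\<close>

lemma distance_sum_eq_parts:
  "distance_sum G v = (\<Sum>u\<in>A. distance G v u) + (\<Sum>u\<in>B. distance G v u)"
  using disjoint finite_A finite_B
  by (simp add: distance_sum_def verts_eq sum.union_disjoint distance_commute[of _ v])

text \<open>The other vertices of \<open>A\<close> cost at least 2 each and those of
  \<open>B\<close> at least 3, except that a neighbour may cost only 1. The savings, 2 for
  \<open>v\<close> itself and 2 per neighbour, stand on the right to avoid subtraction on
  \<open>nat\<close>.\<close>

lemma distance_sum_ge: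
  assumes v: "v \<in> A"
  shows "2 * card A + 3 * card B \<le> distance_sum G v + 2 * card {u \<in> B. (v, u) \<in> parcs G} + 2"
proof -
  have "2 * (card A - 1) = (\<Sum>u\<in>A - {v}. 2)" using v finite_A by simp
  also have "\<dots> \<le> (\<Sum>u\<in>A - {v}. distance G v u)"
    using v distance_same_ge_2[OF v] by (intro sum_mono) auto
  also have "\<dots> \<le> (\<Sum>u\<in>A. distance G v u)" using finite_A by (intro sum_mono2) auto
  finally have 1: "2 * card A \<le> 2 + (\<Sum>u\<in>A. distance G v u)" by simp
  have "3 * card B = (\<Sum>u\<in>B. 3)" by simp
  also have "\<dots> \<le> (\<Sum>u\<in>B. distance G v u + (if (v, u) \<in> parcs G then 2 else 0))"
    using distance_opposite_ge_1[OF v] distance_opposite_ge_3[OF v]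
    by (intro sum_mono) (auto simp: Suc_le_eq)
  also have "\<dots> = (\<Sum>u\<in>B. distance G v u) + 2 * card {u \<in> B. (v, u) \<in> parcs G}"
    using finite_B by (simp add: sum.distrib sum.If_cases Int_def)
  finally show ?thesis using 1 by (simp add: distance_sum_eq_parts)
qed

lemma eccentricity_ge:
  assumes "u \<in> pverts G"
  shows "distance G v u \<le> eccentricity G v"
  unfolding eccentricity_def using assms by (intro Max_ge) auto

lemma eccentricity_ge_2:
  assumes v: "v \<in> A"
  shows "2 \<le> eccentricity G v"
proof -
  have "A \<noteq> {v}" using card_A by auto
  then obtain u where u: "u \<in> A" "u \<noteq> v" using v by auto
  then show ?thesis
    using distance_same_ge_2[of v u] eccentricity_ge[of u v] v verts_eq by fastforce
qed

lemma eccentricity_ge_3: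
  assumes "v \<in> A" "\<not> dominates G B v"
  shows "3 \<le> eccentricity G v"
proof -
  obtain u where u: "u \<in> B" "(v, u) \<notin> parcs G" using assms by (auto simp: dominates_def)
  then show ?thesis
    using distance_opposite_ge_3[of v u] eccentricity_ge[of u v] assms verts_eq by fastforce
qed

section \<open>Uniqueness of dominating vertices and the lower bound for one part\<close>

lemma no_rectangle:
  assumes "a \<in> A" "a' \<in> A" "b \<in> B" "b' \<in> B" "a \<noteq> a'" "b \<noteq> b'"
    and "(a, b) \<in> parcs G" "(a, b') \<in> parcs G" "(a', b) \<in> parcs G" "(a', b') \<in> parcs G"
  shows False
proof -
  have "awalk a [(a, b), (b, a'), (a', b'), (b', a)] a"
    using assms arcs_symmetric verts_eq by (auto simp: awalk_simps)
  then have "cycle [(a, b), (b, a'), (a', b'), (b', a)]"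
    unfolding cycle_def using assms disjoint by (intro exI[of _ a]) auto
  then show False using acyclic by fastforce
qed

text \<open>Two dominating vertices would form a 4-cycle with any two vertices of
  \<open>B\<close>.\<close>

lemma dominates_unique:
  assumes "a \<in> A" "a' \<in> A" "dominates G B a" "dominates G B a'"
  shows "a = a'"
proof (rule ccontr)
  assume "a \<noteq> a'"
  moreover obtain b b' where "b \<in> B" "b' \<in> B" "b \<noteq> b'"
    using card_B card_le_Suc0_iff_eq[OF finite_B] by (metis not_less_eq_eq numeral_2_eq_2)
  ultimately show False using no_rectangle[of a a' b b'] assms by (auto simp: dominates_def)
qed

text \<open>
  The leading term replaces every eccentricity by 3 and every distance sum by its lower bound; the
  last term corrects for a dominating vertex, whose eccentricity is only 2.
\<close>
lemma part_sum_ge: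
  "3 * int (card A) * (2 * int (card A) + 3 * int (card B) - 2) - 6 * card (parcs G \<inter> A \<times> B)
     - (if \<exists>a\<in>A. dominates G B a then 2 * int (card A) + int (card B) - 2 else 0)
   \<le> (\<Sum>v\<in>A. eccentricity G v * distance_sum G v)"
proof -
  define deg where "deg v = card {u \<in> B. (v, u) \<in> parcs G}" for v
  \<comment> \<open>The bound of \<open>distance_sum_ge\<close>, taken over the integers so that
    subtraction does not truncate.\<close>
  define L where "L v = int (2 * card A + 3 * card B) - 2 - 2 * int (deg v)" for v
  have L: "0 \<le> L v" "L v \<le> distance_sum G v" if "v \<in> A" for v
  proof -
    have "deg v \<le> card B" unfolding deg_def using finite_B by (intro card_mono) auto
    then show "0 \<le> L v" using card_A card_B unfolding L_def by linarith
    show "L v \<le> distance_sum G v" 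
      using distance_sum_ge[OF that] unfolding L_def deg_def by linarith
  qed
  have "3 * L v - (if dominates G B v then L v else 0) \<le> int (eccentricity G v * distance_sum G v)"
    if v: "v \<in> A" for v
  proof -
    have "3 * L v - (if dominates G B v then L v else 0) = (if dominates G B v then 2 else 3) * L v"
      by simp
    also have "\<dots> \<le> int (eccentricity G v) * int (distance_sum G v)"
      using L[OF v] eccentricity_ge_2[OF v] eccentricity_ge_3[OF v] by (intro mult_mono) auto
    finally show ?thesis by simp
  qed
  then have "(\<Sum>v\<in>A. 3 * L v - (if dominates G B v then L v else 0))
      \<le> (\<Sum>v\<in>A. int (eccentricity G v * distance_sum G v))"
    by (intro sum_mono) auto
  moreover have "(\<Sum>v\<in>A. 3 * L v)
      = 3 * int (card A) * (2 * int (card A) + 3 * int (card B) - 2) - 6 * card (parcs G \<inter> A \<times> B)"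
  proof -
    \<comment> \<open>Double counting: the degrees over \<open>A\<close> add up to the number of
      arcs from \<open>A\<close> to \<open>B\<close>.\<close>
    have "(\<Sum>v\<in>A. deg v) = card (SIGMA v:A. {u \<in> B. (v, u) \<in> parcs G})"
      unfolding deg_def using finite_A finite_B by (subst card_SigmaI) auto
    also have "(SIGMA v:A. {u \<in> B. (v, u) \<in> parcs G}) = parcs G \<inter> A \<times> B" by auto
    finally have "(\<Sum>v\<in>A. int (deg v)) = card (parcs G \<inter> A \<times> B)"
      by (simp flip: of_nat_sum)
    moreover have "(\<Sum>v\<in>A. 3 * L v)
        = (\<Sum>v\<in>A. 3 * (2 * int (card A) + 3 * int (card B) - 2) - 6 * int (deg v))"
      by (intro sum.cong) (auto simp: L_def)
    ultimately show ?thesis by (simp add: sum_subtractf sum_distrib_left[symmetric])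
  qed
  moreover have "(\<Sum>v\<in>A. if dominates G B v then L v else 0)
      = (if \<exists>a\<in>A. dominates G B a then 2 * int (card A) + int (card B) - 2 else 0)"
  proof (cases "\<exists>a\<in>A. dominates G B a")
    case True
    then obtain a where a: "a \<in> A" "dominates G B a" by blast
    then have "(\<Sum>v\<in>A. if dominates G B v then L v else 0) = (\<Sum>v\<in>A. if v = a then L v else 0)"
      using dominates_unique by (intro sum.cong) auto
    also have "\<dots> = L a" using a finite_A by simp
    \<comment> \<open>The degree of a dominating vertex is the size of \<open>B\<close>, which gives
      the correction term in closed form.\<close>
    also have "{u \<in> B. (a, u) \<in> parcs G} = B" using a by (auto simp: dominates_def)
    then have "L a = 2 * int (card A) + int (card B) - 2"
      by (simp add: L_def deg_def)
    finally show ?thesis using True by simp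
  qed auto
  ultimately show ?thesis
    by (simp add: sum_subtractf)
qed

lemma eccentric_distance_sum_eq:
  "eccentric_distance_sum G = (\<Sum>v\<in>A. eccentricity G v * distance_sum G v)
     + (\<Sum>v\<in>B. eccentricity G v * distance_sum G v)"
  using finite_A finite_B disjoint
  by (simp add: eccentric_distance_sum_def verts_eq sum.union_disjoint)

lemma card_parcs_split: "card (parcs G) = card (parcs G \<inter> A \<times> B) + card (parcs G \<inter> B \<times> A)"
proof -
  have "parcs G = (parcs G \<inter> A \<times> B) \<union> (parcs G \<inter> B \<times> A)"
    using wellformed' verts_eq indep_A indep_B by fastforce
  then show ?thesis using disjoint
    by (subst card_Un_disjoint[symmetric]) auto
qed
end

section \<open>Exact values when each part has a dominating vertex\<close>

context bipartite_tree begin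

lemma distance_self: "v \<in> pverts G \<Longrightarrow> distance G v v = 0"
  using distance_le[of v "[]" v] by (simp add: awalk_Nil_iff)

lemma distance_adjacent_le:
  assumes "(u, v) \<in> parcs G"
  shows "distance G u v \<le> 1"
  using distance_le[of u "[(u, v)]" v] wellformed'[OF assms] assms by (simp add: awalk_simps)

lemma distance_le_Suc:
  assumes "(u, w) \<in> parcs G" "v \<in> pverts G"
  shows "distance G u v \<le> Suc (distance G w v)"
proof -
  obtain r where r: "awalk w r v" "length r = distance G w v"
    using shortest_walk[of w v] assms wellformed' by blast
  then have "awalk u ((u, w) # r) v" using assms by (simp add: awalk_Cons_iff)
  from distance_le[OF this] show ?thesis using r by simp
qed

lemma eccentricity_le:
  assumes "\<And>u. u \<in> pverts G \<Longrightarrow> distance G v u \<le> k"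
  shows "eccentricity G v \<le> k"
proof -
  have "pverts G \<noteq> {}" using card_A verts_eq by auto
  then show ?thesis
    unfolding eccentricity_def using assms by (intro Max.boundedI) auto
qed

context
  fixes a b
  assumes a: "a \<in> A" and b: "b \<in> B"
    and dom_a: "dominates G B a" and dom_b: "dominates G A b"
begin

lemma distance_same_eq:
  assumes "u \<in> A" "v \<in> A" "u \<noteq> v"
  shows "distance G u v = 2"
proof -
  have "(u, b) \<in> parcs G" "(b, v) \<in> parcs G"
    using dom_b assms arcs_symmetric by (auto simp: dominates_def)
  then have "distance G u v \<le> 2"
    using distance_le_Suc[of u b v] distance_adjacent_le[of b v] assms verts_eq by simp
  then show ?thesis using distance_same_ge_2[OF assms] by simp
qed

text \<open>The walk from \<open>u\<close> through \<open>b\<close> and \<open>a\<close> to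
  \<open>v\<close> has length 3.\<close>

lemma distance_opposite_le:
  assumes "u \<in> A" "v \<in> B"
  shows "distance G u v \<le> 3"
proof -
  have "(u, b) \<in> parcs G" "(b, a) \<in> parcs G" "(a, v) \<in> parcs G"
    using dom_a dom_b a assms arcs_symmetric by (auto simp: dominates_def)
  then show ?thesis
    using distance_le_Suc[of u b v] distance_le_Suc[of b a v] distance_adjacent_le[of a v]
      assms verts_eq by simp
qed

text \<open>A second neighbour \<open>u\<close> of \<open>v\<close> would be adjacent to
  \<open>a\<close> too, and \<open>v\<close>, \<open>u\<close>, \<open>a\<close>, \<open>b\<close>
  would form a 4-cycle. So all vertices of \<open>A\<close> other than \<open>a\<close> are pendant
  at \<open>b\<close>.\<close>

lemma neighbors_eq:
  assumes "v \<in> A" "v \<noteq> a"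
  shows "(v, u) \<in> parcs G \<longleftrightarrow> u = b"
proof
  assume vu: "(v, u) \<in> parcs G"
  then have "u \<in> B" using wellformed' verts_eq indep_A assms by blast
  moreover have "(v, b) \<in> parcs G" "(a, b) \<in> parcs G" "(a, u) \<in> parcs G"
    using dom_a dom_b a b assms \<open>u \<in> B\<close> arcs_symmetric by (auto simp: dominates_def)
  ultimately show "u = b" using no_rectangle[of v a u b] vu assms a b by blast
qed (use dom_b assms arcs_symmetric in \<open>auto simp: dominates_def\<close>)

lemma sum_distance_same:
  assumes v: "v \<in> A"
  shows "(\<Sum>u\<in>A. distance G v u) = 2 * (card A - 1)"
proof -
  have "(\<Sum>u\<in>A. distance G v u) = distance G v v + (\<Sum>u\<in>A - {v}. distance G v u)"
    using v finite_A by (rule sum.remove[rotated])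
  also have "(\<Sum>u\<in>A - {v}. distance G v u) = (\<Sum>u\<in>A - {v}. 2)"
    using v distance_same_eq by (intro sum.cong) auto
  finally show ?thesis using v verts_eq finite_A by (simp add: distance_self)
qed

lemma center_contribution:
  "eccentricity G a * distance_sum G a = 2 * (2 * (card A - 1) + card B)"
proof -
  have 1: "distance G a u = 1" if "u \<in> B" for u
    using that dom_a a distance_opposite_ge_1[of a u] distance_adjacent_le[of a u]
    by (auto simp: dominates_def intro: antisym)
  then have "distance_sum G a = 2 * (card A - 1) + card B"
    using sum_distance_same[OF a] by (simp add: distance_sum_eq_parts)
  moreover have "eccentricity G a = 2"
  proof (rule antisym)
    have "distance G a u \<le> 2" if "u \<in> pverts G" for u
      using that 1[of u] distance_same_eq[OF a, of u] distance_self[OF that] verts_eq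
      by (cases "u = a") auto
    then show "eccentricity G a \<le> 2" by (rule eccentricity_le)
  qed (rule eccentricity_ge_2[OF a])
  ultimately show ?thesis by simp
qed

lemma leaf_contribution:
  assumes v: "v \<in> A" "v \<noteq> a"
  shows "eccentricity G v * distance_sum G v = 3 * (2 * (card A - 1) + 3 * (card B - 1) + 1)"
proof -
  have vb: "distance G v b = 1"
    using distance_opposite_ge_1[OF v(1) b] distance_adjacent_le[of v b] neighbors_eq[OF v]
    by (auto intro: antisym)
  have 3: "distance G v u = 3" if "u \<in> B" "u \<noteq> b" for u
    using that neighbors_eq[OF v] distance_opposite_ge_3[OF v(1), of u]
      distance_opposite_le[OF v(1), of u] by (auto intro: antisym)
  have "(\<Sum>u\<in>B. distance G v u) = distance G v b + (\<Sum>u\<in>B - {b}. distance G v u)"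
    using b finite_B by (rule sum.remove[rotated])
  also have "(\<Sum>u\<in>B - {b}. distance G v u) = (\<Sum>u\<in>B - {b}. 3)"
    using 3 by (intro sum.cong) auto
  finally have "distance_sum G v = 2 * (card A - 1) + 3 * (card B - 1) + 1"
    using sum_distance_same[OF v(1)] vb b finite_B by (simp add: distance_sum_eq_parts)
  moreover have "eccentricity G v = 3"
  proof (rule antisym)
    have "distance G v u \<le> 3" if "u \<in> pverts G" for u
      using that distance_opposite_le[OF v(1), of u] distance_same_eq[OF v(1), of u]
        distance_self[OF that] verts_eq
      by (cases "u = v") auto
    then show "eccentricity G v \<le> 3" by (rule eccentricity_le)
    \<comment> \<open>By uniqueness \<open>a\<close> is the only dominating vertex of
      \<open>A\<close>.\<close>
    have "\<not> dominates G B v" using dominates_unique[OF v(1) a _ dom_a] v by blast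
    then show "3 \<le> eccentricity G v" by (rule eccentricity_ge_3[OF v(1)])
  qed
  ultimately show ?thesis by simp
qed

lemma part_sum_eq:
  "(\<Sum>v\<in>A. eccentricity G v * distance_sum G v) = 2 * (2 * (card A - 1) + card B)
     + 3 * (card A - 1) * (2 * (card A - 1) + 3 * (card B - 1) + 1)"
proof -
  have "(\<Sum>v\<in>A. eccentricity G v * distance_sum G v) = eccentricity G a * distance_sum G a
      + (\<Sum>v\<in>A - {a}. eccentricity G v * distance_sum G v)"
    using a finite_A by (rule sum.remove[rotated])
  also have "(\<Sum>v\<in>A - {a}. eccentricity G v * distance_sum G v)
      = (\<Sum>v\<in>A - {a}. 3 * (2 * (card A - 1) + 3 * (card B - 1) + 1))"
    using leaf_contribution by (intro sum.cong) auto
  finally show ?thesis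
    unfolding center_contribution using a finite_A
    by (simp only: sum_constant card_Diff_singleton of_nat_id mult.assoc mult.left_commute)
qed

end
end

text \<open>The eccentric distance sum of T(p, q) in closed form. Each part contributes its centre,
  with eccentricity 2, and its pendant vertices, with eccentricity 3.\<close>

definition double_star_sum :: "nat \<Rightarrow> nat \<Rightarrow> nat" where
  "double_star_sum p q =
     2 * (2 * (p - 1) + q) + 3 * (p - 1) * (2 * (p - 1) + 3 * (q - 1) + 1)
     + (2 * (2 * (q - 1) + p) + 3 * (q - 1) * (2 * (q - 1) + 3 * (p - 1) + 1))"

context bipartite_tree begin

lemma eccentric_distance_sum_if_dominated:
  assumes "a \<in> A" "b \<in> B" "dominates G B a" "dominates G A b"
  shows "eccentric_distance_sum G = double_star_sum (card A) (card B)"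
  using part_sum_eq[OF assms] bipartite_tree.part_sum_eq[OF swap assms(2,1,4,3)]
  by (simp add: eccentric_distance_sum_eq double_star_sum_def)

text \<open>With the largest possible number of arcs and both corrections present, the two bounds
  from \<open>part_sum_ge\<close> add up to exactly \<open>double_star_sum\<close>. Fewer arcs can
  only raise the total, and a missing correction makes it strictly larger.\<close>

lemma eccentric_distance_sum_gt:
  assumes "\<not> ((\<exists>a\<in>A. dominates G B a) \<and> (\<exists>b\<in>B. dominates G A b))"
  shows "double_star_sum (card A) (card B) < eccentric_distance_sum G"
proof -
  define p where "p = int (card A)"
  define q where "q = int (card B)"
  define e where "e = int (card (parcs G \<inter> A \<times> B))"
  define f where "f = int (card (parcs G \<inter> B \<times> A))"
  define corr_A where "corr_A = (if \<exists>a\<in>A. dominates G B a then 2 * p + q - 2 else 0)"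
  define corr_B where "corr_B = (if \<exists>b\<in>B. dominates G A b then 2 * q + p - 2 else 0)"
  have pq: "2 \<le> p" "2 \<le> q" using card_A card_B by (auto simp: p_def q_def)
  have "pverts G \<noteq> {}" using card_A verts_eq by auto
  then have "card (parcs G) + 2 \<le> 2 * card (pverts G)"
    using acyclic by (intro card_parcs_le pair_graph)
  then have edges: "e + f + 2 \<le> 2 * (p + q)"
    using card_parcs_split card_Un_disjoint[OF finite_A finite_B disjoint]
    by (simp add: e_def f_def p_def q_def verts_eq)
  have "3 * p * (2 * p + 3 * q - 2) - 6 * e - corr_A
      + (3 * q * (2 * q + 3 * p - 2) - 6 * f - corr_B) \<le> eccentric_distance_sum G"
    using part_sum_ge bipartite_tree.part_sum_ge[OF swap]
    unfolding eccentric_distance_sum_eq p_def q_def e_def f_def corr_A_def corr_B_def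
    by linarith
  \<comment> \<open>Both full corrections are positive since \<open>p\<close> and \<open>q\<close>
    are at least 2, so losing one is a strict loss.\<close>
  moreover have "corr_A + corr_B < 2 * p + q - 2 + (2 * q + p - 2)"
    using assms pq by (auto simp: corr_A_def corr_B_def)
  moreover have "int (double_star_sum (card A) (card B))
      = 2 * (2 * (p - 1) + q) + 3 * (p - 1) * (2 * (p - 1) + 3 * (q - 1) + 1)
        + (2 * (2 * (q - 1) + p) + 3 * (q - 1) * (2 * (q - 1) + 3 * (p - 1) + 1))"
  proof -
    have "int (card A - 1) = p - 1" "int (card B - 1) = q - 1"
      using card_A card_B by (simp_all add: p_def q_def)
    then show ?thesis
      by (simp only: double_star_sum_def of_nat_add of_nat_mult of_nat_numeral of_nat_1 p_def q_def)
  qed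
  ultimately show ?thesis using edges by (simp add: algebra_simps)
qed

end

section \<open>Double stars\<close>

abbreviation double_star_on :: "'a \<Rightarrow> 'a set \<Rightarrow> 'a \<Rightarrow> 'a set \<Rightarrow> 'a pair_pre_digraph" where
  "double_star_on x S y T \<equiv> attach_pendants y T (attach_pendants x S (edge_graph x y))"

lemma pverts_double_star_on [simp]: "pverts (double_star_on x S y T) = {x, y} \<union> S \<union> T"
  by (simp add: attach_pendants_def edge_graph_def)

lemma parcs_double_star_on:
  "(u, v) \<in> parcs (double_star_on x S y T) \<longleftrightarrow>
     u = x \<and> v = y \<or> u = y \<and> v = x \<or> u = x \<and> v \<in> S \<or> u \<in> S \<and> v = x \<or> u = y \<and> v \<in> T \<or> u \<in> T \<and> v = y"
  by (auto simp: attach_pendants_def edge_graph_def)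

locale double_star_graph =
  fixes x y :: 'a and S T :: "'a set"
  assumes xy: "x \<noteq> y" "x \<notin> S" "x \<notin> T" "y \<notin> S" "y \<notin> T"
    and ST: "S \<inter> T = {}" "finite S" "finite T" "S \<noteq> {}" "T \<noteq> {}"
begin

abbreviation G where "G \<equiv> double_star_on x S y T"

lemma pair_graph: "pair_graph G"
proof
  show fin: "finite (pverts G)" using ST by simp
  have "parcs G \<subseteq> pverts G \<times> pverts G" by (auto simp: parcs_double_star_on)
  then show "finite (parcs G)" using fin by (meson finite_SigmaI finite_subset)
  show "symmetric (with_proj G)"
    unfolding symmetric_def by (rule symI) (auto simp: parcs_double_star_on)
qed (use xy in \<open>auto simp: parcs_double_star_on split_paired_all\<close>)

sublocale pair_graph G by (rule pair_graph)

lemma connected: "connected (with_proj G)"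
proof -
  have to_x: "\<exists>w. awalk u w x" if "u \<in> pverts G" for u
  proof -
    have "awalk u [] x \<or> awalk u [(u, x)] x \<or> awalk u [(u, y), (y, x)] x"
      using that by (auto simp: awalk_simps parcs_double_star_on)
    then show ?thesis by blast
  qed
  have "\<exists>w. awalk u w v" if uv: "u \<in> pverts G" "v \<in> pverts G" for u v
  proof -
    obtain w w' where "awalk u w x" "awalk v w' x" using to_x uv by blast
    then show ?thesis using awalk_appendI awalk_rev_path by blast
  qed
  \<comment> \<open>\<open>connected\<close> refers to the symmetric closure, which has the same
    reachability here because the arcs are already symmetric.\<close>
  then have "strongly_connected (mk_symmetric (with_proj G))"
    using pair_sym_arcs
    by (auto simp: strongly_connected_def reachable_mk_symmetric_eq reachable_awalk
        pverts_mk_symmetric simp del: pverts_double_star_on) simp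
  then show ?thesis by (simp add: connected_def)
qed

lemma two_neighbors_center:
  assumes "(a, v) \<in> parcs G" "(v, b) \<in> parcs G" "a \<noteq> b"
  shows "v = x \<or> v = y"
  using assms xy ST by (auto simp: parcs_double_star_on)

text \<open>
  Every vertex of a cycle of length at least 3 has two neighbours, but only two vertices do.
\<close>
lemma acyclic: "\<not> (\<exists>c. cycle c \<and> 3 \<le> length c)"
proof
  assume "\<exists>c. cycle c \<and> 3 \<le> length c"
  then obtain c u where c: "awalk u c u" "distinct (tl (awalk_verts u c))" "3 \<le> length c"
    by (auto simp: cycle_def)
  \<comment> \<open>The first three arcs pass through \<open>u\<close>, \<open>b\<close>,
    \<open>m\<close>, \<open>d\<close>; the last three of these are distinct and will all be
    centres.\<close>
  then obtain e\<^sub>1 e\<^sub>2 e\<^sub>3 r where "c = e\<^sub>1 # e\<^sub>2 # e\<^sub>3 # r"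
    by (metis Suc_le_length_iff numeral_3_eq_3)
  moreover obtain a b where "e\<^sub>1 = (a, b)" by fastforce
  moreover obtain b' m where "e\<^sub>2 = (b', m)" by fastforce
  moreover obtain m' d where "e\<^sub>3 = (m', d)" by fastforce
  ultimately have w: "(u, b) \<in> parcs G" "(b, m) \<in> parcs G" "(m, d) \<in> parcs G" "awalk d r u"
    and dist: "b \<noteq> m" "b \<notin> set (awalk_verts d r)" "m \<notin> set (awalk_verts d r)"
      "distinct (awalk_verts d r)"
    using c by (auto simp: awalk_Cons_iff)
  have ends: "u \<in> set (awalk_verts d r)" "d \<in> set (awalk_verts d r)"
    using last_in_set[OF awalk_verts_non_Nil, of d r] w(4) hd_in_awalk_verts(1)[OF w(4)] by auto
  \<comment> \<open>The successor of \<open>d\<close> on the cycle; in a triangle \<open>d\<close>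
    is \<open>u\<close>, and this is \<open>b\<close>.\<close>
  obtain z where z: "(d, z) \<in> parcs G" "z \<noteq> m"
  proof (cases r)
    case Nil
    then have "d = u" using w(4) by (simp add: awalk_Nil_iff)
    then show ?thesis using that w(1) dist(1) by blast
  next
    case (Cons e r')
    then have "(d, snd e) \<in> parcs G" "snd e \<in> set (awalk_verts d r)"
      using w(4) hd_in_awalk_verts(1)[of "snd e" r' u] by (cases e, auto simp: awalk_Cons_iff)
    then show ?thesis using that dist(3) by metis
  qed
  have "b = x \<or> b = y" "m = x \<or> m = y" "d = x \<or> d = y"
    using two_neighbors_center[OF w(1,2)] two_neighbors_center[OF w(2,3)]
      two_neighbors_center[OF w(3) z(1)] z dist ends by blast+
  then show False using dist ends by metis
qed

text \<open>The pendant vertices of one centre lie in the part of the other, hence the crossing of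
  \<open>S\<close> and \<open>T\<close>.\<close>

lemma bipartite_tree: "bipartite_tree G (insert x T) (insert y S)"
proof
  show "pverts G = insert x T \<union> insert y S" "insert x T \<inter> insert y S = {}"
    using xy ST by auto
  show "2 \<le> card (insert x T)" "2 \<le> card (insert y S)"
    using xy ST by (auto simp: Suc_le_eq card_gt_0_iff)
  show "(u, v) \<notin> parcs G" if "u \<in> insert x T" "v \<in> insert x T" for u v
    using that xy ST by (auto simp: parcs_double_star_on)
  show "(u, v) \<notin> parcs G" if "u \<in> insert y S" "v \<in> insert y S" for u v
    using that xy ST by (auto simp: parcs_double_star_on)
qed (fact connected acyclic)+

lemma eccentric_distance_sum:
  "eccentric_distance_sum G = double_star_sum (Suc (card T)) (Suc (card S))"
proof -
  interpret bipartite_tree G "insert x T" "insert y S" by (rule bipartite_tree)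
  have "dominates G (insert y S) x" "dominates G (insert x T) y"
    by (auto simp: dominates_def parcs_double_star_on)
  then show ?thesis
    using eccentric_distance_sum_if_dominated[of x y] xy ST by simp
qed

end

text \<open>By \<open>neighbors_eq\<close> every edge meets \<open>a\<close> or \<open>b\<close>.
  This is an equality of graphs; isomorphism enters only when two double stars are compared.\<close>

lemma (in bipartite_tree) eq_double_star_on:
  assumes "a \<in> A" "b \<in> B" "dominates G B a" "dominates G A b"
  shows "G = double_star_on a (B - {b}) b (A - {a})"
proof (rule pair_pre_digraph.equality)
  show "pverts G = pverts (double_star_on a (B - {b}) b (A - {a}))"
    using verts_eq assms by auto
  have "(u, v) \<in> parcs G \<longleftrightarrow> (u, v) \<in> parcs (double_star_on a (B - {b}) b (A - {a}))" (is "?L \<longleftrightarrow> ?R")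
    for u v
  proof
    assume ?L
    have "u = a \<and> v \<in> B \<or> u \<in> A \<and> v = b" if "(u, v) \<in> parcs G" "u \<in> A" for u v
      using that neighbors_eq[OF assms that(2)] wellformed'[OF that(1)] indep_A verts_eq by blast
    \<comment> \<open>The arc or its reverse has its tail in \<open>A\<close>.\<close>
    from this[OF \<open>?L\<close>] this[OF arcs_symmetric[OF \<open>?L\<close>]]
    show ?R using \<open>?L\<close> wellformed'[OF \<open>?L\<close>] indep_B assms verts_eq
      unfolding parcs_double_star_on by blast
  next
    assume ?R
    then show ?L using assms arcs_symmetric
      unfolding parcs_double_star_on dominates_def by blast
  qed
  then show "parcs G = parcs (double_star_on a (B - {b}) b (A - {a}))" by auto
qed simp

lemma digraph_iso_double_star_on:
  assumes "double_star_graph x y S T" "double_star_graph x' y' S' T'"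
    and "card S = card S'" "card T = card T'"
  shows "digraph_iso (with_proj (double_star_on x S y T)) (with_proj (double_star_on x' S' y' T'))"
proof -
  interpret G: double_star_graph x y S T by fact
  interpret H: double_star_graph x' y' S' T' by fact
  obtain g h where g: "bij_betw g S S'" and h: "bij_betw h T T'"
    using assms(3,4) G.ST H.ST finite_same_card_bij by metis
  \<comment> \<open>Centres go to centres, and each set of pendant vertices follows its own
    bijection.\<close>
  define k where
    "k v = (if v = x then x' else if v = y then y' else if v \<in> S then g v else h v)" for v
  have kx: "k x = x'" and ky: "k y = y'" using G.xy by (auto simp: k_def)
  have kS: "bij_betw k S S'" using g G.xy
    by (subst bij_betw_cong[where g = g]) (auto simp: k_def)
  have kT: "bij_betw k T T'" using h G.xy G.ST
    by (subst bij_betw_cong[where g = h]) (auto simp: k_def)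
  have bij: "bij_betw k ({x, y} \<union> S \<union> T) ({x', y'} \<union> S' \<union> T')"
  proof (intro bij_betw_combine)
    show "bij_betw k {x, y} {x', y'}" using kx ky G.xy H.xy by (auto simp: bij_betw_def)
  qed (use kS kT G.xy G.ST H.xy H.ST in auto)
  have arcs: "parcs H.G = map_prod k k ` parcs G.G"
  proof -
    have "S' = k ` S" "T' = k ` T" using kS kT by (auto simp: bij_betw_def)
    then show ?thesis using kx ky
      by (simp add: attach_pendants_def edge_graph_def image_Un map_prod_surj_on[OF refl refl])
  qed
  let ?f = "\<lparr>iso_verts = k, iso_arcs = map_prod k k, iso_head = snd, iso_tail = fst\<rparr>"
  have inj: "inj_on k (pverts G.G)" using bij by (simp add: bij_betw_def)
  have "inj_on (map_prod k k) (parcs G.G)"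
    by (rule inj_on_subset[OF map_prod_inj_on[OF inj inj]]) (auto dest: G.wellformed')
  then have "G.digraph_isomorphism ?f"
    unfolding G.digraph_isomorphism_def using inj by (simp add: G.wf_digraph_axioms)
  moreover have "with_proj H.G = app_iso ?f (with_proj G.G)"
    using bij arcs unfolding with_proj_def app_iso_def by (simp add: bij_betw_def)
  ultimately show ?thesis unfolding digraph_iso_def by blast
qed

text \<open>Carries the shape along the isomorphism. Equality of the sums then follows from the
  closed formula, with no general invariance argument.\<close>

lemma double_star_on_if_digraph_iso:
  assumes "double_star_graph x y S T"
    and "digraph_iso (with_proj (double_star_on x S y T)) (with_proj G)"
  obtains x' y' S' T' where "double_star_graph x' y' S' T'" "G = double_star_on x' S' y' T'"
    "card S' = card S" "card T' = card T"
proof -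
  interpret D: double_star_graph x y S T by fact
  obtain f where f: "D.digraph_isomorphism f" "with_proj G = app_iso f (with_proj D.G)"
    using assms(2) by (auto simp: digraph_iso_def)
  define k where "k = iso_verts f"
  have inj: "inj_on k ({x, y} \<union> S \<union> T)"
    using D.digraph_isomorphism_inj_on_verts[OF f(1)] by (simp add: k_def)
  \<comment> \<open>Passing to end points eliminates the arc map of \<open>f\<close>, leaving only
    its vertex map.\<close>
  have "arcs_ends (with_proj G) = map_prod k k ` parcs D.G"
    unfolding f(2) D.arcs_ends_app_iso_eq[OF f(1)] by (simp add: k_def map_prod_def)
  then have arcs: "parcs G = map_prod k k ` parcs D.G" by simp
  have verts: "pverts G = k ` pverts D.G"
    using arg_cong[OF f(2), of verts] by (simp add: k_def)
  have "G = double_star_on (k x) (k ` S) (k y) (k ` T)"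
    by (rule pair_pre_digraph.equality)
      (simp_all add: verts arcs attach_pendants_def edge_graph_def image_Un
        map_prod_surj_on[OF refl refl])
  moreover have "double_star_graph (k x) (k y) (k ` S) (k ` T)"
    using inj D.xy D.ST by (intro double_star_graph.intro) (auto 0 3 dest: inj_onD)
  moreover have "card (k ` S) = card S" "card (k ` T) = card T"
    using inj by (auto intro!: card_image elim: inj_on_subset)
  ultimately show ?thesis using that by blast
qed

section \<open>Trees with a given bipartition and the extremal theorem\<close>

lemma bipartite_treeI:
  assumes "G \<in> bipartition_trees n p q" "2 \<le> p" "2 \<le> q"
  obtains A B where "bipartite_tree G A B" "card A = p" "card B = q"
proof -
  obtain A B where "A \<union> B = pverts G" "A \<inter> B = {}" "independent_set G A" "independent_set G B"
    "card A = p" "card B = q" "undirected_tree G"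
    using assms(1) by (auto simp: bipartition_trees_def has_bipartition_def)
  then have "bipartite_tree G A B"
    using assms(2,3)
    by (auto simp: bipartite_tree_def bipartite_tree_axioms_def undirected_tree_def
        independent_set_def)
  then show ?thesis using that \<open>card A = p\<close> \<open>card B = q\<close> by blast
qed

lemma (in bipartite_tree) in_bipartition_trees:
  "G \<in> bipartition_trees (card A + card B) (card A) (card B)"
proof -
  have "has_bipartition (card A) (card B) G"
    unfolding has_bipartition_def independent_set_def
    using verts_eq disjoint indep_A indep_B by (intro exI[of _ A] exI[of _ B]) auto
  then show ?thesis
    using connected acyclic pair_graph disjoint finite_A finite_B
    by (simp add: bipartition_trees_def undirected_tree_def verts_eq card_Un_disjoint)
qed

text \<open>Uniqueness is up to isomorphism because \<open>double_star p q\<close> lives on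
  \<open>nat\<close> and its competitors on any vertex type.\<close>

theorem theorem4p2:
  fixes n p q :: nat
  assumes "3 \<le> p" and "p \<le> q" and "n = p + q"
  shows "double_star p q \<in> bipartition_trees n p q \<and>
    (\<forall>G :: 'a pair_pre_digraph. G \<in> bipartition_trees n p q \<longrightarrow>
       eccentric_distance_sum (double_star p q) \<le> eccentric_distance_sum G \<and>
       (eccentric_distance_sum G = eccentric_distance_sum (double_star p q) \<longleftrightarrow>
          digraph_iso (with_proj G) (with_proj (double_star p q))))"
proof -
  define S T where "S = {2..<q + 1}" and "T = {q + 1..<p + q}"
  have star: "double_star p q = double_star_on 0 S 1 T"
    by (simp add: double_star_def S_def T_def)
  interpret D: double_star_graph 0 1 S T
    using assms by unfold_locales (auto simp: S_def T_def)
  have card: "Suc (card S) = q" "Suc (card T) = p" using assms by (auto simp: S_def T_def)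
  have sum: "eccentric_distance_sum (double_star p q) = double_star_sum p q"
    using D.eccentric_distance_sum by (simp only: star card)
  have "card (insert 0 T) = p" "card (insert 1 S) = q" using card D.xy D.ST by auto
  then have mem: "double_star p q \<in> bipartition_trees n p q"
    using bipartite_tree.in_bipartition_trees[OF D.bipartite_tree] by (simp add: star assms(3))
  have "double_star_sum p q \<le> eccentric_distance_sum G \<and>
      (eccentric_distance_sum G = double_star_sum p q \<longleftrightarrow>
        digraph_iso (with_proj G) (with_proj (double_star p q)))"
    if G: "G \<in> bipartition_trees n p q" for G :: "'a pair_pre_digraph"
  proof -
    obtain A B where "bipartite_tree G A B" and AB: "card A = p" "card B = q"
      using bipartite_treeI[OF G] assms by auto
    then interpret bipartite_tree G A B by simp
    show ?thesis
    proof (cases "(\<exists>a\<in>A. dominates G B a) \<and> (\<exists>b\<in>B. dominates G A b)")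
      case True
      then obtain a b where ab: "a \<in> A" "b \<in> B" "dominates G B a" "dominates G A b" by blast
      have cards: "card (B - {b}) = card S" "card (A - {a}) = card T"
        using ab finite_A finite_B card AB by auto
      have "double_star_graph a b (B - {b}) (A - {a})"
      proof
        have "card (B - {b}) \<noteq> 0" "card (A - {a}) \<noteq> 0" using cards card assms by auto
        then show "B - {b} \<noteq> {}" "A - {a} \<noteq> {}" by force+
      qed (use ab disjoint finite_A finite_B in auto)
      then have "digraph_iso (with_proj G) (with_proj (double_star p q))"
        using digraph_iso_double_star_on[OF _ D.double_star_graph_axioms cards]
          eq_double_star_on[OF ab] star by simp
      then show ?thesis using eccentric_distance_sum_if_dominated[OF ab] AB by simp
    next
      case False
      then have "double_star_sum p q < eccentric_distance_sum G"
        using eccentric_distance_sum_gt AB by simp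
      \<comment> \<open>With the strict inequality this rules out an isomorphism, so both sides of
        the equivalence are false in this case.\<close>
      moreover have "eccentric_distance_sum G = double_star_sum p q"
        if iso: "digraph_iso (with_proj G) (with_proj (double_star p q))"
      proof -
        have "digraph_iso (with_proj (double_star p q)) (with_proj G)"
          using iso wf_digraph_axioms by (rule digraph_iso_swap[rotated])
        then obtain x y U V where "double_star_graph x y U V" "G = double_star_on x U y V"
          "card U = card S" "card V = card T"
          using double_star_on_if_digraph_iso[OF D.double_star_graph_axioms] star by metis
        then show ?thesis using double_star_graph.eccentric_distance_sum card by metis
      qed
      ultimately show ?thesis by auto
    qed
  qed
  then show ?thesis using mem sum by simp
qed

end
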